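(* Let $G$ be a group with a free product decomposition $G=H\ast L$ where the space of ends of $H$ is a Cantor space. Then the induced map from $\mathcal{E}^\star(H)$ to $\mathcal{E}^\star(G)$ is injective, and in particular the space of ends of $G$ includes a Cantor space and the Boolean algebra $\mathcal{P}_{G}^\star(G)$ has an infinite countable quotient (namely $\mathcal{P}_{H}^\star(H)$).
   Context: A subset $A$ of a group $G$ is left $G$-commensurated if $gA\bigtriangleup A$ is finite for every $g\in G$. These subsets form a Boolean subalgebra $\mathcal{P}_{(G)}(G)$ of the power set of $G$; $\mathcal{P}^\star_G(G)$ denotes its quotient by the ideal of finite subsets of $G$. The space of ends $\mathcal{E}^\star(G)$ is the Stone dual of $\mathcal{P}^\star_G(G)$, i.e. the compact Hausdorff totally disconnected space whose Boolean algebra of clopen subsets is $\mathcal{P}^\star_G(G)$. If $H$ is a subgroup of $G$, then $A\mapsto A\cap H$ maps left $G$-commensurated subsets of $G$ to left $H$-commensurated subsets of $H$ and induces a Boolean algebra homomorphism $\mathcal{P}^\star_G(G)\to\mathcal{P}^\star_H(H)$; the induced map $\mathcal{E}^\star(H)\to\mathcal{E}^\star(G)$ is the continuous map corresponding to it by Stone duality. *)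

theory Defs
  imports "HOL-Algebra.QuotRing" "HOL-Analysis.Function_Topology"
begin

section \<open>Free products\<close>

text \<open>
  The free product of two groups is realised on the reduced words: alternating words in the
  non-identity elements of the two groups, multiplied by concatenation followed by reduction.
\<close>

definition letters :: "('a, 'm) monoid_scheme \<Rightarrow> ('b, 'n) monoid_scheme \<Rightarrow> ('a + 'b) set" where
  "letters A B = Inl ` (carrier A - {\<one>\<^bsub>A\<^esub>}) \<union> Inr ` (carrier B - {\<one>\<^bsub>B\<^esub>})"

definition reduced_words ::
    "('a, 'm) monoid_scheme \<Rightarrow> ('b, 'n) monoid_scheme \<Rightarrow> ('a + 'b) list set" where
  "reduced_words A B =
     {w \<in> lists (letters A B). successively (\<lambda>x y. isl x \<noteq> isl y) w}"

text \<open>Multiplication of a reduced word on the left by a single (possibly trivial) letter.\<close>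

fun push_letter ::
    "('a, 'm) monoid_scheme \<Rightarrow> ('b, 'n) monoid_scheme \<Rightarrow> 'a + 'b \<Rightarrow> ('a + 'b) list \<Rightarrow> ('a + 'b) list"
where
  "push_letter A B (Inl a) (Inl a' # w) =
     (if a \<otimes>\<^bsub>A\<^esub> a' = \<one>\<^bsub>A\<^esub> then w else Inl (a \<otimes>\<^bsub>A\<^esub> a') # w)"
| "push_letter A B (Inr b) (Inr b' # w) =
     (if b \<otimes>\<^bsub>B\<^esub> b' = \<one>\<^bsub>B\<^esub> then w else Inr (b \<otimes>\<^bsub>B\<^esub> b') # w)"
| "push_letter A B (Inl a) w = (if a = \<one>\<^bsub>A\<^esub> then w else Inl a # w)"
| "push_letter A B (Inr b) w = (if b = \<one>\<^bsub>B\<^esub> then w else Inr b # w)"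

definition free_product ::
    "('a, 'm) monoid_scheme \<Rightarrow> ('b, 'n) monoid_scheme \<Rightarrow> ('a + 'b) list monoid" where
  "free_product A B =
     \<lparr>carrier = reduced_words A B, mult = (\<lambda>u v. foldr (push_letter A B) u v), one = []\<rparr>"

definition eval_word :: "('a, 'm) monoid_scheme \<Rightarrow> ('a + 'a) list \<Rightarrow> 'a" where
  "eval_word G w = foldr (\<lambda>x y. case_sum id id x \<otimes>\<^bsub>G\<^esub> y) w \<one>\<^bsub>G\<^esub>"

text \<open>
  \<open>G = H * L\<close>: the canonical map from the free product of the subgroups \<open>H\<close> and \<open>L\<close>
  to \<open>G\<close> is an isomorphism.
\<close>

definition free_product_decomposition ::
    "('a, 'm) monoid_scheme \<Rightarrow> 'a set \<Rightarrow> 'a set \<Rightarrow> bool" where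
  "free_product_decomposition G H L \<longleftrightarrow>
     subgroup H G \<and> subgroup L G \<and>
     eval_word G \<in> iso (free_product (G\<lparr>carrier := H\<rparr>) (G\<lparr>carrier := L\<rparr>)) G"


section \<open>Boolean algebras of commensurated subsets\<close>

text \<open>
  Boolean algebras are represented as Boolean rings: the product is the meet and the sum is the
  symmetric difference, so that \<open>x \<squnion> y = x + y + x y\<close>, \<open>- x = 1 + x\<close> and
  \<open>x \<le> y \<longleftrightarrow> x y = x\<close>.  Homomorphisms, ideals and quotients of Boolean algebras are those of
  (unital) rings.
\<close>

definition commensurated :: "('a, 'm) monoid_scheme \<Rightarrow> 'a set \<Rightarrow> bool" where
  "commensurated G A \<longleftrightarrow>
     A \<subseteq> carrier G \<and> (\<forall>g\<in>carrier G. finite (sym_diff (g <#\<^bsub>G\<^esub> A) A))"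

definition commensurated_algebra :: "('a, 'm) monoid_scheme \<Rightarrow> 'a set ring" where
  "commensurated_algebra G =
     \<lparr>carrier = {A. commensurated G A}, mult = (\<inter>), one = carrier G,
      zero = {}, add = sym_diff\<rparr>"

definition finite_subsets :: "('a, 'm) monoid_scheme \<Rightarrow> 'a set set" where
  "finite_subsets G = {A. A \<subseteq> carrier G \<and> finite A}"

definition ends_algebra :: "('a, 'm) monoid_scheme \<Rightarrow> 'a set set ring" where
  "ends_algebra G = commensurated_algebra G Quot finite_subsets G"

text \<open>
  The homomorphism induced by \<open>A \<mapsto> A \<inter> H\<close>.  An element \<open>X\<close> of the quotient is a class of
  commensurated subsets of \<open>G\<close>; all its members have the same image.
\<close>

definition ends_restrict :: "('a, 'm) monoid_scheme \<Rightarrow> 'a set \<Rightarrow> 'a set set \<Rightarrow> 'a set set" where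
  "ends_restrict G H X =
     the_elem ((\<lambda>A. finite_subsets (G\<lparr>carrier := H\<rparr>)
                      +>\<^bsub>commensurated_algebra (G\<lparr>carrier := H\<rparr>)\<^esub> (A \<inter> H)) ` X)"


section \<open>Stone duality and the space of ends\<close>

definition ultrafilters :: "('b, 'm) ring_scheme \<Rightarrow> 'b set set" where
  "ultrafilters R =
     {U. U \<subseteq> carrier R \<and> \<one>\<^bsub>R\<^esub> \<in> U \<and> \<zero>\<^bsub>R\<^esub> \<notin> U \<and>
         (\<forall>x\<in>U. \<forall>y\<in>U. x \<otimes>\<^bsub>R\<^esub> y \<in> U) \<and>
         (\<forall>x\<in>U. \<forall>y\<in>carrier R. x \<otimes>\<^bsub>R\<^esub> y = x \<longrightarrow> y \<in> U) \<and>
         (\<forall>x\<in>carrier R. x \<in> U \<or> \<one>\<^bsub>R\<^esub> \<oplus>\<^bsub>R\<^esub> x \<in> U)}"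

definition stone_space :: "('b, 'm) ring_scheme \<Rightarrow> 'b set topology" where
  "stone_space R =
     topology_generated_by ((\<lambda>x. {U \<in> ultrafilters R. x \<in> U}) ` carrier R)"

definition stone_map :: "('b, 'm) ring_scheme \<Rightarrow> ('b \<Rightarrow> 'c) \<Rightarrow> 'c set \<Rightarrow> 'b set" where
  "stone_map R f U = {x \<in> carrier R. f x \<in> U}"

definition ends_space :: "('a, 'm) monoid_scheme \<Rightarrow> 'a set set set topology" where
  "ends_space G = stone_space (ends_algebra G)"

definition ends_map :: "('a, 'm) monoid_scheme \<Rightarrow> 'a set \<Rightarrow> 'a set set set \<Rightarrow> 'a set set set" where
  "ends_map G H = stone_map (ends_algebra G) (ends_restrict G H)"

definition cantor_space :: "(nat \<Rightarrow> bool) topology" where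
  "cantor_space = product_topology (\<lambda>_. discrete_topology UNIV) UNIV"


section \<open>The definitions yield groups, Boolean rings, ideals and homomorphisms\<close>

lemma l_coset_eq_vimage: assumes "group G" "A \<subseteq> carrier G" "g \<in> carrier G"
  shows "g <#\<^bsub>G\<^esub> A = {x \<in> carrier G. inv\<^bsub>G\<^esub> g \<otimes>\<^bsub>G\<^esub> x \<in> A}"
proof -
  interpret group G by fact
  show ?thesis
  proof (intro equalityI subsetI)
    fix x assume "x \<in> g <#\<^bsub>G\<^esub> A" then show "x \<in> {x \<in> carrier G. inv\<^bsub>G\<^esub> g \<otimes>\<^bsub>G\<^esub> x \<in> A}"
      using assms by (auto simp: l_coset_def m_assoc[symmetric])
  next
    fix x assume x: "x \<in> {x \<in> carrier G. inv\<^bsub>G\<^esub> g \<otimes>\<^bsub>G\<^esub> x \<in> A}"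
    then have "x = g \<otimes>\<^bsub>G\<^esub> (inv\<^bsub>G\<^esub> g \<otimes>\<^bsub>G\<^esub> x)" using assms by (simp add: m_assoc[symmetric])
    then show "x \<in> g <#\<^bsub>G\<^esub> A" using x unfolding l_coset_def by blast
  qed
qed

lemma commensurated_Int: assumes "group G" "commensurated G A" "commensurated G B"
  shows "commensurated G (A \<inter> B)"
  unfolding commensurated_def
proof (intro conjI ballI)
  show "A \<inter> B \<subseteq> carrier G" using assms by (auto simp: commensurated_def)
  fix g assume g: "g \<in> carrier G"
  have s: "A \<subseteq> carrier G" "B \<subseteq> carrier G" "A \<inter> B \<subseteq> carrier G" using assms by (auto simp: commensurated_def)
  have "sym_diff (g <#\<^bsub>G\<^esub> (A\<inter>B)) (A\<inter>B) \<subseteq> sym_diff (g <#\<^bsub>G\<^esub> A) A \<union> sym_diff (g <#\<^bsub>G\<^esub> B) B"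
    unfolding l_coset_eq_vimage[OF assms(1) s(1) g] l_coset_eq_vimage[OF assms(1) s(2) g] l_coset_eq_vimage[OF assms(1) s(3) g]
    by auto
  then show "finite (sym_diff (g <#\<^bsub>G\<^esub> (A\<inter>B)) (A\<inter>B))"
    using assms g by (metis commensurated_def finite_Un finite_subset)
qed

lemma commensurated_sym_diff: assumes "group G" "commensurated G A" "commensurated G B"
  shows "commensurated G (sym_diff A B)"
  unfolding commensurated_def
proof (intro conjI ballI)
  show "sym_diff A B \<subseteq> carrier G" using assms by (auto simp: commensurated_def)
  fix g assume g: "g \<in> carrier G"
  have s: "A \<subseteq> carrier G" "B \<subseteq> carrier G" "sym_diff A B \<subseteq> carrier G" using assms by (auto simp: commensurated_def)
  have "sym_diff (g <#\<^bsub>G\<^esub> (sym_diff A B)) (sym_diff A B) \<subseteq> sym_diff (g <#\<^bsub>G\<^esub> A) A \<union> sym_diff (g <#\<^bsub>G\<^esub> B) B"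
    unfolding l_coset_eq_vimage[OF assms(1) s(1) g] l_coset_eq_vimage[OF assms(1) s(2) g] l_coset_eq_vimage[OF assms(1) s(3) g]
    by auto
  then show "finite (sym_diff (g <#\<^bsub>G\<^esub> (sym_diff A B)) (sym_diff A B))"
    using assms g by (metis commensurated_def finite_Un finite_subset)
qed

lemma commensurated_finite: assumes "A \<subseteq> carrier G" "finite A" shows "commensurated G A"
  using assms by (auto simp: commensurated_def l_coset_def)

lemma commensurated_carrier: assumes "group G" shows "commensurated G (carrier G)"
proof -
  interpret group G by fact
  show ?thesis proof -
    have "{x \<in> carrier G. inv\<^bsub>G\<^esub> g \<otimes>\<^bsub>G\<^esub> x \<in> carrier G} = carrier G" if "g \<in> carrier G" for g
      using that by auto
    then show ?thesis by (simp add: commensurated_def l_coset_eq_vimage[OF assms subset_refl])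
  qed
qed

lemma cring_commensurated_algebra: assumes "group G" shows "cring (commensurated_algebra G)"
proof (intro cringI abelian_groupI comm_monoidI)
  fix A assume "A \<in> carrier (commensurated_algebra G)"
  then show "\<exists>y\<in>carrier (commensurated_algebra G). y \<oplus>\<^bsub>commensurated_algebra G\<^esub> A = \<zero>\<^bsub>commensurated_algebra G\<^esub>"
    by (auto simp: commensurated_algebra_def)
qed (insert assms, auto simp: commensurated_algebra_def commensurated_Int commensurated_sym_diff commensurated_finite commensurated_carrier, auto simp: commensurated_def)

lemma ideal_finite_subsets: assumes "group G" shows "ideal (finite_subsets G) (commensurated_algebra G)"
proof -
  interpret cring "commensurated_algebra G" by (rule cring_commensurated_algebra[OF assms])
  have neg: "\<ominus>\<^bsub>commensurated_algebra G\<^esub> A = A" if "A \<in> carrier (commensurated_algebra G)" for A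
    by (rule minus_equality) (use that in \<open>auto simp: commensurated_algebra_def\<close>)
  have neg: "inv\<^bsub>add_monoid (commensurated_algebra G)\<^esub> A = A" if "A \<in> carrier (commensurated_algebra G)" for A
    using neg[OF that] by (simp add: a_inv_def)
  show ?thesis
  proof (rule idealI)
    show "subgroup (finite_subsets G) (add_monoid (commensurated_algebra G))"
    proof (rule add.subgroupI)
      show "finite_subsets G \<subseteq> carrier (commensurated_algebra G)"
        by (auto simp: finite_subsets_def commensurated_algebra_def commensurated_finite)
      then show "\<And>A. A \<in> finite_subsets G \<Longrightarrow> \<ominus>\<^bsub>commensurated_algebra G\<^esub> A \<in> finite_subsets G"
        using neg by (metis subsetD a_inv_def)
    qed (auto simp: finite_subsets_def commensurated_algebra_def)
  qed (use ring_axioms in \<open>auto simp: finite_subsets_def commensurated_algebra_def commensurated_def\<close>)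
qed

lemma commensurated_restrict: assumes "group G" "subgroup H G" "commensurated G A"
  shows "commensurated (G\<lparr>carrier := H\<rparr>) (A \<inter> H)"
  unfolding commensurated_def
proof (intro conjI ballI)
  show "A \<inter> H \<subseteq> carrier (G\<lparr>carrier := H\<rparr>)" by auto
  fix g assume "g \<in> carrier (G\<lparr>carrier := H\<rparr>)" then have g: "g \<in> H" "g \<in> carrier G" using subgroup.subset[OF assms(2)] by auto
  interpret group G by fact
  have l: "g <#\<^bsub>G\<lparr>carrier := H\<rparr>\<^esub> (A \<inter> H) = (g <#\<^bsub>G\<^esub> A) \<inter> H"
  proof -
    have "x \<in> g <#\<^bsub>G\<lparr>carrier := H\<rparr>\<^esub> (A \<inter> H)" if xx: "x \<in> (g <#\<^bsub>G\<^esub> A)" "x \<in> H" for x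
    proof -
      obtain a where a: "a \<in> A" "x = g \<otimes>\<^bsub>G\<^esub> a" using xx unfolding l_coset_def by blast
      then have "a = inv\<^bsub>G\<^esub> g \<otimes>\<^bsub>G\<^esub> x" using g assms(3) by (auto simp: commensurated_def m_assoc[symmetric])
      then have "a \<in> H" using g xx subgroup.m_closed[OF assms(2)] subgroup.m_inv_closed[OF assms(2)] by auto
      then show ?thesis using a by (auto simp: l_coset_def)
    qed
    moreover have "g <#\<^bsub>G\<lparr>carrier := H\<rparr>\<^esub> (A \<inter> H) \<subseteq> (g <#\<^bsub>G\<^esub> A) \<inter> H"
      using g subgroup.m_closed[OF assms(2)] by (auto simp: l_coset_def)
    ultimately show ?thesis by blast
  qed
  show "finite (sym_diff (g <#\<^bsub>G\<lparr>carrier := H\<rparr>\<^esub> (A \<inter> H)) (A \<inter> H))"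
    unfolding l
    by (rule finite_subset[of _ "sym_diff (g <#\<^bsub>G\<^esub> A) A"]) (use assms g in \<open>auto simp: commensurated_def\<close>)
qed

lemma push_mult:
  assumes "group A" "group B" "w \<in> reduced_words A B"
  shows "x \<in> carrier A \<Longrightarrow> y \<in> carrier A \<Longrightarrow> push_letter A B (Inl x) (push_letter A B (Inl y) w) = push_letter A B (Inl (x \<otimes>\<^bsub>A\<^esub> y)) w"
   and "u \<in> carrier B \<Longrightarrow> v \<in> carrier B \<Longrightarrow> push_letter A B (Inr u) (push_letter A B (Inr v) w) = push_letter A B (Inr (u \<otimes>\<^bsub>B\<^esub> v)) w"
proof -
  interpret A: group A by fact
  interpret B: group B by fact
  { assume x: "x \<in> carrier A" "y \<in> carrier A"
   show "push_letter A B (Inl x) (push_letter A B (Inl y) w) = push_letter A B (Inl (x \<otimes>\<^bsub>A\<^esub> y)) w"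
   proof (cases w)
     case Nil then show ?thesis using x by auto
   next
     case (Cons l t)
     show ?thesis
     proof (cases l)
       case (Inl a)
       have a: "a \<in> carrier A" "a \<noteq> \<one>\<^bsub>A\<^esub>" using assms(3) Cons Inl by (auto simp: reduced_words_def letters_def)
       have t: "push_letter A B (Inl x) t = (if x = \<one>\<^bsub>A\<^esub> then t else Inl x # t)" for x
         using assms(3) Cons Inl by (cases t; cases "hd t") (auto simp: reduced_words_def)
       have "x \<otimes>\<^bsub>A\<^esub> y \<otimes>\<^bsub>A\<^esub> a = x \<otimes>\<^bsub>A\<^esub> (y \<otimes>\<^bsub>A\<^esub> a)" using x a by (simp add: A.m_assoc)
       then show ?thesis using x a Cons Inl by (auto simp: t)
     next
       case (Inr b) then show ?thesis using x Cons by auto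
     qed
   qed }
  { assume x: "u \<in> carrier B" "v \<in> carrier B"
   show "push_letter A B (Inr u) (push_letter A B (Inr v) w) = push_letter A B (Inr (u \<otimes>\<^bsub>B\<^esub> v)) w"
   proof (cases w)
     case Nil then show ?thesis using x by auto
   next
     case (Cons l t)
     show ?thesis
     proof (cases l)
       case (Inr a)
       have a: "a \<in> carrier B" "a \<noteq> \<one>\<^bsub>B\<^esub>" using assms(3) Cons Inr by (auto simp: reduced_words_def letters_def)
       have t: "push_letter A B (Inr x) t = (if x = \<one>\<^bsub>B\<^esub> then t else Inr x # t)" for x
         using assms(3) Cons Inr by (cases t; cases "hd t") (auto simp: reduced_words_def)
       have "u \<otimes>\<^bsub>B\<^esub> v \<otimes>\<^bsub>B\<^esub> a = u \<otimes>\<^bsub>B\<^esub> (v \<otimes>\<^bsub>B\<^esub> a)" using x a by (simp add: B.m_assoc)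
       then show ?thesis using x a Cons Inr by (auto simp: t)
     next
       case (Inl b) then show ?thesis using x Cons by auto
     qed
   qed }
qed


lemma reduced_words_Cons:
  "h # t \<in> reduced_words A B \<longleftrightarrow>
     h \<in> letters A B \<and> t \<in> reduced_words A B \<and> (t = [] \<or> isl h \<noteq> isl (hd t))"
  by (auto simp: reduced_words_def successively_Cons)

lemma push_closed: assumes "group A" "group B" "w \<in> reduced_words A B" "l \<in> Inl ` carrier A \<union> Inr ` carrier B"
  shows "push_letter A B l w \<in> reduced_words A B"
proof -
  interpret A: group A by fact
  interpret B: group B by fact
  show ?thesis
  proof (cases w)
    case Nil
    then show ?thesis using assms(4) by (cases l) (auto simp: reduced_words_def letters_def)
  next
    case (Cons h t)
    have w: "h \<in> letters A B" "t \<in> reduced_words A B" "t = [] \<or> isl h \<noteq> isl (hd t)"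
      using assms(3) Cons by (auto simp: reduced_words_Cons)
    have l: "Inl a \<in> letters A B \<longleftrightarrow> a \<in> carrier A \<and> a \<noteq> \<one>\<^bsub>A\<^esub>"
      "Inr b \<in> letters A B \<longleftrightarrow> b \<in> carrier B \<and> b \<noteq> \<one>\<^bsub>B\<^esub>" for a b
      by (auto simp: letters_def)
    show ?thesis
      using assms(4) w unfolding Cons
      by (cases l; cases h) (auto simp: reduced_words_Cons l)
  qed
qed

lemma foldr_closed: assumes "group A" "group B" "w \<in> reduced_words A B" "set u \<subseteq> Inl ` carrier A \<union> Inr ` carrier B"
  shows "foldr (push_letter A B) u w \<in> reduced_words A B"
  using assms(4) by (induction u) (use assms(3) in \<open>auto simp: push_closed[OF assms(1,2)]\<close>)

lemma rw_letters: "u \<in> reduced_words A B \<Longrightarrow> set u \<subseteq> Inl ` carrier A \<union> Inr ` carrier B"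
  by (auto simp: reduced_words_def letters_def lists_eq_set)

lemma push_act: assumes "group A" "group B" "w \<in> reduced_words A B" "v \<in> reduced_words A B" "l \<in> Inl ` carrier A \<union> Inr ` carrier B"
  shows "foldr (push_letter A B) (push_letter A B l v) w = push_letter A B l (foldr (push_letter A B) v w)"
proof -
  interpret A: group A by fact
  interpret B: group B by fact
  have one: "push_letter A B (Inl \<one>\<^bsub>A\<^esub>) z = z" "push_letter A B (Inr \<one>\<^bsub>B\<^esub>) z = z" if "z \<in> reduced_words A B" for z
  proof -
    show "push_letter A B (Inl \<one>\<^bsub>A\<^esub>) z = z"
      using that by (cases z; cases "hd z") (auto simp: reduced_words_Cons letters_def)
    show "push_letter A B (Inr \<one>\<^bsub>B\<^esub>) z = z"
      using that by (cases z; cases "hd z") (auto simp: reduced_words_Cons letters_def)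
  qed
  note f = foldr_closed[OF assms(1,2,3)]
  have sub: "set t \<subseteq> Inl ` carrier A \<union> Inr ` carrier B \<and> h \<in> Inl ` carrier A \<union> Inr ` carrier B" if "h # t \<in> reduced_words A B" for h t
    using rw_letters[OF that] by auto
  show ?thesis
  proof (cases v)
    case Nil then show ?thesis using assms(5) one assms(3) by auto
  next
    case (Cons h t)
    have st: "set t \<subseteq> Inl ` carrier A \<union> Inr ` carrier B" "h \<in> Inl ` carrier A \<union> Inr ` carrier B" using sub assms(4) Cons by auto
    show ?thesis
    proof (cases l; cases h)
      fix a a' assume lh: "l = Inl a" "h = Inl a'"
      then show ?thesis
        using assms(5) st push_mult(1)[OF assms(1,2) f[OF st(1)], of a a'] one(1)[OF f[OF st(1)]] Cons
        by auto
    next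
      fix b b' assume lh: "l = Inr b" "h = Inr b'"
      then show ?thesis
        using assms(5) st push_mult(2)[OF assms(1,2) f[OF st(1)], of b b'] one(2)[OF f[OF st(1)]] Cons
        by auto
    next
      fix a b assume lh: "l = Inl a" "h = Inr b"
      then show ?thesis
        using one(1)[OF push_closed[OF assms(1,2) f[OF st(1)] st(2)]] Cons by simp
    next
      fix a b assume lh: "l = Inr b" "h = Inl a"
      then show ?thesis
        using one(2)[OF push_closed[OF assms(1,2) f[OF st(1)] st(2)]] Cons by simp
    qed
  qed
qed

lemma group_free_product: assumes "group A" "group B" shows "group (free_product A B)"
proof -
  interpret A: group A by fact
  interpret B: group B by fact
  let ?C = "Inl ` carrier A \<union> Inr ` carrier B"
  have nil: "[] \<in> reduced_words A B" by (auto simp: reduced_words_def)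
  have id: "foldr (push_letter A B) u [] = u" if "u \<in> reduced_words A B" for u
    using that
  proof (induction u)
    case (Cons h t)
    then have "t \<in> reduced_words A B" by (simp add: reduced_words_Cons)
    then show ?case using Cons
      by (cases h; cases t; cases "hd t") (auto simp: reduced_words_Cons letters_def)
  qed simp
  have assoc: "foldr (push_letter A B) (foldr (push_letter A B) u v) w = foldr (push_letter A B) u (foldr (push_letter A B) v w)"
    if "set u \<subseteq> ?C" "v \<in> reduced_words A B" "w \<in> reduced_words A B" for u v w
    using that(1)
  proof (induction u)
    case (Cons h t)
    then show ?case using push_act[OF assms that(3) foldr_closed[OF assms that(2)], of t h] by simp
  qed simp
  have inv: "\<exists>v. set v \<subseteq> ?C \<and> foldr (push_letter A B) v u = []" if "u \<in> reduced_words A B" for u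
    using that
  proof (induction u)
    case Nil then show ?case by (intro exI[of _ "[]"]) auto
  next
    case (Cons h t)
    then have t: "t \<in> reduced_words A B" by (simp add: reduced_words_Cons)
    then obtain v where v: "set v \<subseteq> ?C" "foldr (push_letter A B) v t = []" using Cons by auto
    obtain h' where "h' \<in> ?C" "push_letter A B h' (h # t) = t"
    proof (cases h)
      case (Inl a)
      then show ?thesis using rw_letters[OF Cons.prems] by (intro that[of "Inl (inv\<^bsub>A\<^esub> a)"]) auto
    next
      case (Inr a)
      then show ?thesis using rw_letters[OF Cons.prems] by (intro that[of "Inr (inv\<^bsub>B\<^esub> a)"]) auto
    qed
    then show ?case using v by (intro exI[of _ "v @ [h']"]) auto
  qed
  show ?thesis
  proof (rule groupI)
    fix u assume "u \<in> carrier (free_product A B)"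
    then have u: "u \<in> reduced_words A B" by (simp add: free_product_def)
    obtain v where v: "set v \<subseteq> ?C" "foldr (push_letter A B) v u = []" using inv[OF u] by auto
    let ?v = "foldr (push_letter A B) v []"
    have "?v \<in> reduced_words A B" by (rule foldr_closed[OF assms nil v(1)])
    moreover have "foldr (push_letter A B) ?v u = []" using assoc[OF v(1) nil u] v by simp
    ultimately show "\<exists>y\<in>carrier (free_product A B). y \<otimes>\<^bsub>free_product A B\<^esub> u = \<one>\<^bsub>free_product A B\<^esub>"
      by (auto simp: free_product_def)
  qed (auto simp: free_product_def nil foldr_closed[OF assms] rw_letters assoc)
qed

lemma restrict_hom:
  assumes "group G" "subgroup H G"
  shows "(\<lambda>A. A \<inter> H) \<in> ring_hom (commensurated_algebra G) (commensurated_algebra (G\<lparr>carrier := H\<rparr>))"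
  using commensurated_restrict[OF assms] subgroup.subset[OF assms(2)]
  by (auto simp: ring_hom_def commensurated_algebra_def)

lemma ends_restrict_coset:
  assumes "group G" "subgroup H G" "commensurated G A"
  shows "ends_restrict G H (finite_subsets G +>\<^bsub>commensurated_algebra G\<^esub> A)
      = finite_subsets (G\<lparr>carrier := H\<rparr>) +>\<^bsub>commensurated_algebra (G\<lparr>carrier := H\<rparr>)\<^esub> (A \<inter> H)"
proof -
  let ?H = "G\<lparr>carrier := H\<rparr>"
  have gH: "group ?H" using assms by (simp add: subgroup.subgroup_is_group)
  interpret IG: ideal "finite_subsets G" "commensurated_algebra G" by (rule ideal_finite_subsets[OF assms(1)])
  interpret IH: ideal "finite_subsets ?H" "commensurated_algebra ?H" by (rule ideal_finite_subsets[OF gH])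
  have A: "A \<in> carrier (commensurated_algebra G)" using assms by (simp add: commensurated_algebra_def)
  have "finite_subsets ?H +>\<^bsub>commensurated_algebra ?H\<^esub> (B \<inter> H) = finite_subsets ?H +>\<^bsub>commensurated_algebra ?H\<^esub> (A \<inter> H)"
    if B: "B \<in> finite_subsets G +>\<^bsub>commensurated_algebra G\<^esub> A" for B
  proof -
    obtain F where F: "finite F" "F \<subseteq> carrier G" "B = sym_diff F A" using B
      by (auto simp: a_r_coset_def r_coset_def finite_subsets_def commensurated_algebra_def)
    have "B \<inter> H = (F \<inter> H) \<oplus>\<^bsub>commensurated_algebra ?H\<^esub> (A \<inter> H)" using F by (auto simp: commensurated_algebra_def)
    moreover have "F \<inter> H \<in> finite_subsets ?H" using F by (auto simp: finite_subsets_def)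
    ultimately have "B \<inter> H \<in> finite_subsets ?H +>\<^bsub>commensurated_algebra ?H\<^esub> (A \<inter> H)"
      by (auto simp: a_r_coset_def r_coset_def)
    then show ?thesis
      using IH.a_repr_independence'[of "B \<inter> H" "A \<inter> H"] commensurated_restrict[OF assms]
      by (simp add: commensurated_algebra_def)
  qed
  moreover have "A \<in> finite_subsets G +>\<^bsub>commensurated_algebra G\<^esub> A" using A by (rule IG.a_rcos_self)
  ultimately have "(\<lambda>B. finite_subsets ?H +>\<^bsub>commensurated_algebra ?H\<^esub> (B \<inter> H)) ` (finite_subsets G +>\<^bsub>commensurated_algebra G\<^esub> A)
     = {finite_subsets ?H +>\<^bsub>commensurated_algebra ?H\<^esub> (A \<inter> H)}" by blast
  then show ?thesis unfolding ends_restrict_def by simp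
qed

lemma ends_restrict_hom:
  assumes "group G" "subgroup H G"
  shows "ends_restrict G H \<in> ring_hom (ends_algebra G) (ends_algebra (G\<lparr>carrier := H\<rparr>))"
proof -
  let ?H = "G\<lparr>carrier := H\<rparr>"
  have gH: "group ?H" using assms by (simp add: subgroup.subgroup_is_group)
  interpret IG: ideal "finite_subsets G" "commensurated_algebra G" by (rule ideal_finite_subsets[OF assms(1)])
  interpret IH: ideal "finite_subsets ?H" "commensurated_algebra ?H" by (rule ideal_finite_subsets[OF gH])
  have h: "(\<lambda>A. finite_subsets ?H +>\<^bsub>commensurated_algebra ?H\<^esub> (A \<inter> H)) \<in> ring_hom (commensurated_algebra G) (ends_algebra ?H)"
    using ring_hom_trans[OF restrict_hom[OF assms] IH.rcos_ring_hom] by (simp add: ends_algebra_def comp_def)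
  have c: "ends_restrict G H (finite_subsets G +>\<^bsub>commensurated_algebra G\<^esub> A) = finite_subsets ?H +>\<^bsub>commensurated_algebra ?H\<^esub> (A \<inter> H)"
    if "A \<in> carrier (commensurated_algebra G)" for A
    using ends_restrict_coset[OF assms] that by (simp add: commensurated_algebra_def)
  have ex: "\<exists>A\<in>carrier (commensurated_algebra G). X = finite_subsets G +>\<^bsub>commensurated_algebra G\<^esub> A" if "X \<in> carrier (ends_algebra G)" for X
    using that by (auto simp: ends_algebra_def FactRing_def A_RCOSETS_def' )
  show ?thesis
  proof (rule ring_hom_memI)
    fix X assume "X \<in> carrier (ends_algebra G)"
    then show "ends_restrict G H X \<in> carrier (ends_algebra ?H)" using ex[of X] c ring_hom_closed[OF h] by auto
  next
    fix X Y assume "X \<in> carrier (ends_algebra G)" "Y \<in> carrier (ends_algebra G)"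
    then obtain A B where AB: "A\<in>carrier (commensurated_algebra G)" "X = finite_subsets G +>\<^bsub>commensurated_algebra G\<^esub> A"
       "B\<in>carrier (commensurated_algebra G)" "Y = finite_subsets G +>\<^bsub>commensurated_algebra G\<^esub> B" using ex by metis
    have "X \<otimes>\<^bsub>ends_algebra G\<^esub> Y = finite_subsets G +>\<^bsub>commensurated_algebra G\<^esub> (A \<otimes>\<^bsub>commensurated_algebra G\<^esub> B)"
      using AB IG.rcoset_mult_add by (simp add: ends_algebra_def FactRing_def)
    then show "ends_restrict G H (X \<otimes>\<^bsub>ends_algebra G\<^esub> Y) = ends_restrict G H X \<otimes>\<^bsub>ends_algebra ?H\<^esub> ends_restrict G H Y"
      using AB c ring_hom_mult[OF h AB(1,3)] by (simp)
    have "X \<oplus>\<^bsub>ends_algebra G\<^esub> Y = finite_subsets G +>\<^bsub>commensurated_algebra G\<^esub> (A \<oplus>\<^bsub>commensurated_algebra G\<^esub> B)"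
      using AB IG.a_rcos_sum by (simp add: ends_algebra_def FactRing_def)
    then show "ends_restrict G H (X \<oplus>\<^bsub>ends_algebra G\<^esub> Y) = ends_restrict G H X \<oplus>\<^bsub>ends_algebra ?H\<^esub> ends_restrict G H Y"
      using AB c ring_hom_add[OF h AB(1,3)] by (simp)
  next
    show "ends_restrict G H \<one>\<^bsub>ends_algebra G\<^esub> = \<one>\<^bsub>ends_algebra ?H\<^esub>"
      using c[OF IG.one_closed] ring_hom_one[OF h] by (simp add: ends_algebra_def FactRing_def)
  qed
qed

lemma topspace_stone_space: "ring R \<Longrightarrow> topspace (stone_space R) = ultrafilters R"
  using ring.ring_simprules(6)[of R]
  by (auto simp: stone_space_def topology_generated_by_topspace ultrafilters_def)

lemma continuous_map_stone_map:
  assumes "ring R" "ring S" and f: "f \<in> ring_hom R S"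
  shows "continuous_map (stone_space S) (stone_space R) (stone_map R f)"
proof -
  interpret R: ring R by fact
  interpret S: ring S by fact
  interpret f: ring_hom_ring R S f
    by (rule ring_hom_ringI2) (use assms in auto)
  have mem: "stone_map R f U \<in> ultrafilters R" if U: "U \<in> ultrafilters S" for U
  proof -
    have up: "f y \<in> U" if "f x \<in> U" "x \<in> carrier R" "y \<in> carrier R" "x \<otimes>\<^bsub>R\<^esub> y = x" for x y
    proof -
      have "f x \<otimes>\<^bsub>S\<^esub> f y = f x"
        using that by (metis f.hom_mult)
      then show ?thesis using U that by (simp add: ultrafilters_def)
    qed
    have "f x \<in> U \<or> f (\<one>\<^bsub>R\<^esub> \<oplus>\<^bsub>R\<^esub> x) \<in> U" if "x \<in> carrier R" for x
      using that U by (simp add: ultrafilters_def)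
    then show ?thesis
      using U up by (auto simp: ultrafilters_def stone_map_def)
  qed
  show ?thesis
    unfolding stone_space_def[of R]
  proof (rule continuous_on_generated_topo)
    fix V assume "V \<in> (\<lambda>x. {U \<in> ultrafilters R. x \<in> U}) ` carrier R"
    then obtain x where x: "x \<in> carrier R" "V = {U \<in> ultrafilters R. x \<in> U}" by blast
    have "stone_map R f -` V \<inter> topspace (stone_space S) = {U \<in> ultrafilters S. f x \<in> U}"
      using x mem by (auto simp: topspace_stone_space[OF assms(2)] stone_map_def)
    moreover have "openin (stone_space S) {U \<in> ultrafilters S. f x \<in> U}"
      unfolding stone_space_def by (rule topology_generated_by_Basis) (use x in auto)
    ultimately show "openin (stone_space S) (stone_map R f -` V \<inter> topspace (stone_space S))"
      by simp
  next
    show "stone_map R f ` topspace (stone_space S) \<subseteq> \<Union> ((\<lambda>x. {U \<in> ultrafilters R. x \<in> U}) ` carrier R)"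
      using mem topspace_stone_space[OF assms(1)]
      by (auto simp: topspace_stone_space[OF assms(2)] stone_space_def topology_generated_by_topspace)
  qed
qed

end

theory Submission
  imports Defs "HOL-Analysis.T1_Spaces"
begin

text \<open>
  Everything follows from surjectivity of the restriction homomorphism between the ends algebras,
  and this holds for any free factor \<open>H\<close> of \<open>G = H * L\<close>.  In the Bass--Serre tree of the
  decomposition, removing the vertex \<open>H\<close> leaves one branch for each \<open>h \<in> H\<close>, made of
  the elements \<open>u h\<close> with \<open>u\<close> a reduced word ending in \<open>L\<close>.  Collapsing every
  branch to its \<open>h\<close> is a retraction \<open>r : G \<rightarrow> H\<close>; on reduced words it
  reads off the last letter, if that letter is in \<open>H\<close>, and gives \<open>\<one>\<close> otherwise
  (lemma \<open>free_product_retraction\<close>).  Left multiplication acts on the beginning of a word, so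
  it changes the last letter only of very short words: \<open>r\<close> is invariant under left
  multiplication by \<open>L\<close> everywhere, and by \<open>H\<close> outside \<open>H\<close>.  Hence, for a
  left commensurated \<open>A \<subseteq> H\<close>, the preimage \<open>B\<close> of \<open>A\<close> under
  \<open>r\<close> satisfies \<open>l B = B\<close> for \<open>l \<in> L\<close>, while \<open>h B\<close> and
  \<open>B\<close> differ exactly where \<open>h A\<close> and \<open>A\<close> do for \<open>h \<in> H\<close>.  Since
  \<open>H\<close> and \<open>L\<close> generate \<open>G\<close>, the set \<open>B\<close> is commensurated, and it
  meets \<open>H\<close> in \<open>A\<close> (lemma \<open>commensurated_extend\<close>).

  By duality the map on ends is injective.  Its source is compact, being a Cantor space, and its
  target is Hausdorff, so the map is an embedding and its image is a Cantor space.  The first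
  isomorphism theorem identifies the quotient by the kernel.  For the cardinality of the ends
  algebra of \<open>H\<close>, Stone's representation embeds it into the compact open subsets of the
  Cantor space; these are countably many, as each is a finite union of sets of a countable basis.
  The algebra cannot be finite, for then there would be finitely many ultrafilters
  (lemma \<open>cantor_dual_imp_infinite_countable\<close>).
\<close>

section \<open>Extending commensurated subsets from a free factor\<close>

definition last_left :: "('a, 'm) monoid_scheme \<Rightarrow> ('a + 'b) list \<Rightarrow> 'a" where
  "last_left A w = (if w \<noteq> [] \<and> isl (last w) then projl (last w) else \<one>\<^bsub>A\<^esub>)"

text \<open>
  Pushing a letter on the left alters at most the first letter of the word or adds one before it.
  The last letter is therefore at risk only for words of length at most one; among these, an
  \<open>Inr\<close> letter leaves the value at \<open>\<one>\<close>, or leaves a final \<open>Inl\<close> letter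
  alone.
\<close>

lemma last_left_push_letter:
  assumes "isl l \<Longrightarrow> w \<noteq> [] \<and> (\<forall>a. w \<noteq> [Inl a])"
  shows "last_left A (push_letter A B l w) = last_left A w"
proof (cases w)
  case Nil
  then show ?thesis using assms by (cases l) (auto simp: last_left_def)
next
  case (Cons x t)
  then show ?thesis using assms by (cases l; cases x) (auto simp: last_left_def)
qed

lemma last_left_closed:
  assumes "group A" "w \<in> reduced_words A B"
  shows "last_left A w \<in> carrier A"
proof -
  interpret group A by fact
  have "last w \<in> letters A B" if "w \<noteq> []"
    using assms(2) that by (auto simp: reduced_words_def)
  then show ?thesis by (auto simp: last_left_def letters_def)
qed

text \<open>
  The function \<^const>\<open>last_left\<close>, carried from reduced words to \<open>G\<close>.  The exceptional
  words of lemma \<open>last_left_push_letter\<close> are those which represent the elements of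
  \<open>H\<close>.
\<close>

lemma free_product_retraction:
  assumes G: "group G" and dec: "free_product_decomposition G H L"
  obtains r where "\<And>x. x \<in> carrier G \<Longrightarrow> r x \<in> H" "\<And>h. h \<in> H \<Longrightarrow> r h = h"
    "\<And>h x. h \<in> H \<Longrightarrow> x \<in> carrier G - H \<Longrightarrow> r (h \<otimes>\<^bsub>G\<^esub> x) = r x"
    "\<And>l x. l \<in> L \<Longrightarrow> x \<in> carrier G \<Longrightarrow> r (l \<otimes>\<^bsub>G\<^esub> x) = r x"
proof -
  interpret group G by fact
  let ?A = "G\<lparr>carrier := H\<rparr>" and ?B = "G\<lparr>carrier := L\<rparr>"
  let ?F = "free_product ?A ?B" and ?W = "reduced_words ?A ?B" and ?\<phi> = "eval_word G"
  have sub: "subgroup H G" "subgroup L G" and iso: "?\<phi> \<in> iso ?F G"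
    using dec by (auto simp: free_product_decomposition_def)
  have HL: "H \<subseteq> carrier G" "L \<subseteq> carrier G" "\<one>\<^bsub>G\<^esub> \<in> H"
    using sub by (auto dest: subgroup.subset subgroup.one_closed)
  have bij: "bij_betw ?\<phi> ?W (carrier G)"
    using iso by (simp add: iso_def free_product_def)
  define r where "r = last_left ?A \<circ> inv_into ?W ?\<phi>"
  have r_eval: "r (?\<phi> w) = last_left ?A w" if "w \<in> ?W" for w
    using bij_betw_inv_into_left[OF bij that] by (simp add: r_def)
  have eval: "\<exists>w\<in>?W. x = ?\<phi> w" if "x \<in> carrier G" for x
    using that bij by (auto simp: bij_betw_def)
  have letter: "?\<phi> (push_letter ?A ?B l w) = case_sum id id l \<otimes>\<^bsub>G\<^esub> ?\<phi> w \<and> push_letter ?A ?B l w \<in> ?W"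
    if l: "l \<in> letters ?A ?B" and w: "w \<in> ?W" for l w
  proof -
    \<comment> \<open>Pushing \<open>l\<close> is the product with the one-letter word \<open>[l]\<close> in the free product.\<close>
    have lw: "[l] \<in> ?W" using l by (simp add: reduced_words_def)
    have cl: "case_sum id id l \<in> carrier G" using l HL by (auto simp: letters_def)
    have "?\<phi> (push_letter ?A ?B l w) = ?\<phi> [l] \<otimes>\<^bsub>G\<^esub> ?\<phi> w"
      using iso_imp_homomorphism[OF iso] lw w by (auto simp: hom_def free_product_def)
    moreover have "push_letter ?A ?B l w \<in> ?W"
      using push_closed[OF _ _ w] l sub G by (force simp: letters_def subgroup.subgroup_is_group)
    ultimately show ?thesis using cl by (simp add: eval_word_def)
  qed
  have short: "?\<phi> w \<in> H" if "w = [] \<or> (\<exists>a. w = [Inl a])" "w \<in> ?W" for w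
    using that HL by (auto simp: eval_word_def reduced_words_def letters_def)
  show ?thesis
  proof (rule that[of r])
    fix x assume "x \<in> carrier G"
    then obtain w where "w \<in> ?W" "x = ?\<phi> w" using eval by blast
    then show "r x \<in> H"
      using last_left_closed[of ?A w ?B] r_eval sub G by (simp add: subgroup.subgroup_is_group)
  next
    fix h assume h: "h \<in> H"
    \<comment> \<open>The reduced word of \<open>h\<close>; the identity is not allowed as a letter.\<close>
    define w :: "('a + 'a) list" where "w = (if h = \<one>\<^bsub>G\<^esub> then [] else [Inl h])"
    have "w \<in> ?W" "?\<phi> w = h" "last_left ?A w = h"
      using h HL by (auto simp: w_def reduced_words_def letters_def eval_word_def last_left_def)
    then show "r h = h" using r_eval by metis
  next
    fix h x assume h: "h \<in> H" and x: "x \<in> carrier G - H"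
    obtain w where w: "w \<in> ?W" "x = ?\<phi> w" using eval x by blast
    have long: "w \<noteq> [] \<and> (\<forall>a. w \<noteq> [Inl a])" using short x w by blast
    show "r (h \<otimes>\<^bsub>G\<^esub> x) = r x"
    proof (cases "h = \<one>\<^bsub>G\<^esub>")
      case False
      then have "Inl h \<in> letters ?A ?B" using h by (simp add: letters_def)
      from letter[OF this w(1)] last_left_push_letter[of "Inl h" w ?A ?B] long r_eval w
      show ?thesis by (metis id_apply old.sum.simps(5))
    qed (use x in simp)
  next
    fix l x assume l: "l \<in> L" and x: "x \<in> carrier G"
    obtain w where w: "w \<in> ?W" "x = ?\<phi> w" using eval x by blast
    show "r (l \<otimes>\<^bsub>G\<^esub> x) = r x"
    proof (cases "l = \<one>\<^bsub>G\<^esub>")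
      case False
      then have "Inr l \<in> letters ?A ?B" using l by (simp add: letters_def)
      from letter[OF this w(1)] last_left_push_letter[of "Inr l" w ?A ?B] r_eval w
      show ?thesis by (metis id_apply old.sum.simps(6) sum.disc(2))
    qed (use x in simp)
  qed
qed

text \<open>
  The preimage of \<open>A\<close> under the retraction is fixed by \<open>L\<close>, and \<open>H\<close> moves it
  only inside \<open>H\<close>, where it is \<open>A\<close>.  The elements that move it by a finite set are
  closed under products, so both factors together account for all of \<open>G\<close>.
\<close>

lemma commensurated_extend:
  assumes G: "group G" and dec: "free_product_decomposition G H L"
    and A: "commensurated (G\<lparr>carrier := H\<rparr>) A"
  shows "\<exists>B. commensurated G B \<and> B \<inter> H = A"
proof -
  interpret group G by fact
  have sub: "subgroup H G" "subgroup L G" and iso: "eval_word G \<in> iso (free_product (G\<lparr>carrier := H\<rparr>) (G\<lparr>carrier := L\<rparr>)) G"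
    using dec by (auto simp: free_product_decomposition_def)
  have HL: "H \<subseteq> carrier G" "L \<subseteq> carrier G" using sub by (auto dest: subgroup.subset)
  have AH: "A \<subseteq> H" and fin: "\<And>h. h \<in> H \<Longrightarrow> finite (sym_diff (h <#\<^bsub>G\<^esub> A) A)"
    using A by (auto simp: commensurated_def l_coset_def)
  obtain r where r: "\<And>x. x \<in> carrier G \<Longrightarrow> r x \<in> H" "\<And>h. h \<in> H \<Longrightarrow> r h = h"
    "\<And>h x. h \<in> H \<Longrightarrow> x \<in> carrier G - H \<Longrightarrow> r (h \<otimes>\<^bsub>G\<^esub> x) = r x"
    "\<And>l x. l \<in> L \<Longrightarrow> x \<in> carrier G \<Longrightarrow> r (l \<otimes>\<^bsub>G\<^esub> x) = r x"
    using free_product_retraction[OF G dec] by blast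
  define B where "B = {x \<in> carrier G. r x \<in> A}"
  have B: "B \<subseteq> carrier G" by (auto simp: B_def)
  have L_inv: "finite (sym_diff (l <#\<^bsub>G\<^esub> B) B)" if l: "l \<in> L" for l
  proof -
    have "inv\<^bsub>G\<^esub> l \<in> L" using l sub by (simp add: subgroup.m_inv_closed)
    then have "r (inv\<^bsub>G\<^esub> l \<otimes>\<^bsub>G\<^esub> x) = r x" if "x \<in> carrier G" for x using r(4) that by blast
    then have "l <#\<^bsub>G\<^esub> B = B"
      using l HL unfolding l_coset_eq_vimage[OF G B subsetD[OF HL(2) l]] by (auto simp: B_def)
    then show ?thesis by simp
  qed
  have H_inv: "finite (sym_diff (h <#\<^bsub>G\<^esub> B) B)" if h: "h \<in> H" for h
  proof (rule finite_subset[OF _ fin[OF h]])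
    have ih: "inv\<^bsub>G\<^esub> h \<in> H" using h sub by (simp add: subgroup.m_inv_closed)
    have hG: "h \<in> carrier G" "A \<subseteq> carrier G" using h HL AH by auto
    have out: "x \<in> h <#\<^bsub>G\<^esub> B \<longleftrightarrow> x \<in> B" if "x \<in> carrier G - H" for x
      using r(3)[OF ih that] that hG unfolding l_coset_eq_vimage[OF G B hG(1)] by (auto simp: B_def)
    have ins: "(x \<in> h <#\<^bsub>G\<^esub> B \<longleftrightarrow> x \<in> h <#\<^bsub>G\<^esub> A) \<and> (x \<in> B \<longleftrightarrow> x \<in> A)" if x: "x \<in> H" for x
    proof -
      have "inv\<^bsub>G\<^esub> h \<otimes>\<^bsub>G\<^esub> x \<in> H" using ih x sub by (simp add: subgroup.m_closed)
      then show ?thesis using r(2) x HL hG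
        unfolding l_coset_eq_vimage[OF G B hG(1)] l_coset_eq_vimage[OF G hG(2,1)] by (auto simp: B_def)
    qed
    have "h <#\<^bsub>G\<^esub> B \<subseteq> carrier G" using hG B by (auto simp: l_coset_def)
    then show "sym_diff (h <#\<^bsub>G\<^esub> B) B \<subseteq> sym_diff (h <#\<^bsub>G\<^esub> A) A"
      using out ins B by blast
  qed
  have mult: "finite (sym_diff ((g \<otimes>\<^bsub>G\<^esub> k) <#\<^bsub>G\<^esub> B) B)"
    if g: "g \<in> carrier G" "finite (sym_diff (g <#\<^bsub>G\<^esub> B) B)"
      and k: "k \<in> carrier G" "finite (sym_diff (k <#\<^bsub>G\<^esub> B) B)" for g k
  proof (rule finite_subset)
    have "(g \<otimes>\<^bsub>G\<^esub> k) <#\<^bsub>G\<^esub> B = g <#\<^bsub>G\<^esub> (k <#\<^bsub>G\<^esub> B)"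
      using g k B by (simp add: lcos_m_assoc)
    then show "sym_diff ((g \<otimes>\<^bsub>G\<^esub> k) <#\<^bsub>G\<^esub> B) B
        \<subseteq> (g <#\<^bsub>G\<^esub> sym_diff (k <#\<^bsub>G\<^esub> B) B) \<union> sym_diff (g <#\<^bsub>G\<^esub> B) B"
      by (auto simp: l_coset_def)
    show "finite ((g <#\<^bsub>G\<^esub> sym_diff (k <#\<^bsub>G\<^esub> B) B) \<union> sym_diff (g <#\<^bsub>G\<^esub> B) B)"
      using g(2) k(2) by (simp add: l_coset_def)
  qed
  have words: "eval_word G w \<in> carrier G \<and> finite (sym_diff (eval_word G w <#\<^bsub>G\<^esub> B) B)"
    if "set w \<subseteq> Inl ` H \<union> Inr ` L" for w
    using that
  proof (induction w)
    case Nil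
    then show ?case using B by (simp add: eval_word_def lcos_mult_one)
  next
    case (Cons l w)
    then have w: "eval_word G w \<in> carrier G" "finite (sym_diff (eval_word G w <#\<^bsub>G\<^esub> B) B)" by auto
    have l: "case_sum id id l \<in> H \<union> L" using Cons.prems by auto
    then have "case_sum id id l \<in> carrier G" "finite (sym_diff (case_sum id id l <#\<^bsub>G\<^esub> B) B)"
      using HL L_inv H_inv by blast+
    from mult[OF this w] this(1) w(1) show ?case by (simp add: eval_word_def)
  qed
  have "finite (sym_diff (g <#\<^bsub>G\<^esub> B) B)" if "g \<in> carrier G" for g
  proof -
    obtain w where w: "w \<in> reduced_words (G\<lparr>carrier := H\<rparr>) (G\<lparr>carrier := L\<rparr>)" "g = eval_word G w"
      using iso \<open>g \<in> carrier G\<close> by (auto simp: iso_def bij_betw_def free_product_def)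
    then show ?thesis using words[of w] rw_letters[OF w(1)] by simp
  qed
  then have "commensurated G B" using B by (simp add: commensurated_def)
  moreover have "B \<inter> H = A" using r(2) AH HL by (auto simp: B_def)
  ultimately show ?thesis by blast
qed

lemma ends_restrict_surj:
  assumes G: "group G" and dec: "free_product_decomposition G H L"
  shows "ends_restrict G H ` carrier (ends_algebra G) = carrier (ends_algebra (G\<lparr>carrier := H\<rparr>))"
proof
  have sub: "subgroup H G" using dec by (simp add: free_product_decomposition_def)
  show "ends_restrict G H ` carrier (ends_algebra G) \<subseteq> carrier (ends_algebra (G\<lparr>carrier := H\<rparr>))"
    using ring_hom_closed[OF ends_restrict_hom[OF G sub]] by blast
  show "carrier (ends_algebra (G\<lparr>carrier := H\<rparr>)) \<subseteq> ends_restrict G H ` carrier (ends_algebra G)"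
  proof
    fix Y assume "Y \<in> carrier (ends_algebra (G\<lparr>carrier := H\<rparr>))"
    then obtain A where A: "commensurated (G\<lparr>carrier := H\<rparr>) A"
      "Y = finite_subsets (G\<lparr>carrier := H\<rparr>) +>\<^bsub>commensurated_algebra (G\<lparr>carrier := H\<rparr>)\<^esub> A"
      by (auto simp: ends_algebra_def FactRing_def A_RCOSETS_def' commensurated_algebra_def)
    obtain B where B: "commensurated G B" "B \<inter> H = A" using commensurated_extend[OF G dec A(1)] by blast
    then have "Y = ends_restrict G H (finite_subsets G +>\<^bsub>commensurated_algebra G\<^esub> B)"
      using ends_restrict_coset[OF G sub] A(2) by simp
    moreover have "finite_subsets G +>\<^bsub>commensurated_algebra G\<^esub> B \<in> carrier (ends_algebra G)"
      using B by (auto simp: ends_algebra_def FactRing_def A_RCOSETS_def' commensurated_algebra_def)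
    ultimately show "Y \<in> ends_restrict G H ` carrier (ends_algebra G)" by blast
  qed
qed

section \<open>Stone duality for Boolean rings\<close>

text \<open>
  The sets of ultrafilters containing a given element are a basis of clopen sets of the Stone space.
  The representation by these sets is faithful because there are enough ultrafilters.
\<close>

locale boolean_ring = cring R for R (structure) +
  assumes idem: "x \<in> carrier R \<Longrightarrow> x \<otimes> x = x"
begin

lemma add_self: assumes x: "x \<in> carrier R" shows "x \<oplus> x = \<zero>"
proof -
  have "x \<oplus> x = (x \<oplus> x) \<otimes> (x \<oplus> x)" using x by (simp add: idem)
  also have "\<dots> = (x \<oplus> x) \<oplus> (x \<oplus> x)" by (simp only: l_distr r_distr x a_closed) (simp only: idem x)
  finally show ?thesis using x by simp
qed

lemma mult_compl: assumes x: "x \<in> carrier R" shows "x \<otimes> (\<one> \<oplus> x) = \<zero>"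
  using x by (simp add: r_distr idem add_self)

lemma add_eq_zero: assumes "x \<in> carrier R" "y \<in> carrier R" "x \<oplus> y = \<zero>" shows "x = y"
  using assms add_self by (metis minus_equality)

lemma ultrafilter_compl_iff:
  assumes U: "U \<in> ultrafilters R" and x: "x \<in> carrier R"
  shows "\<one> \<oplus> x \<in> U \<longleftrightarrow> x \<notin> U"
proof
  assume c: "\<one> \<oplus> x \<in> U"
  show "x \<notin> U"
  proof
    assume "x \<in> U"
    then have "x \<otimes> (\<one> \<oplus> x) \<in> U" using c U unfolding ultrafilters_def by blast
    then show False using U mult_compl[OF x] by (simp add: ultrafilters_def)
  qed
next
  assume "x \<notin> U" then show "\<one> \<oplus> x \<in> U" using U x unfolding ultrafilters_def by blast
qed

lemma ultrafilter_in_carrier: "U \<in> ultrafilters R \<Longrightarrow> x \<in> U \<Longrightarrow> x \<in> carrier R"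
  unfolding ultrafilters_def by blast

text \<open>
  The Boolean prime ideal theorem.  Zorn's lemma gives a maximal proper filter \<open>U\<close> containing
  \<open>x\<close>.  For an element \<open>z\<close> whose meet with some \<open>u \<in> U\<close> is zero, the
  complement of \<open>z\<close> lies above \<open>u\<close>; for any other \<open>z\<close>, the filter generated by
  \<open>U\<close> and \<open>z\<close> is proper, so it equals \<open>U\<close> by maximality.
\<close>

lemma ultrafilter_exists:
  assumes x: "x \<in> carrier R" "x \<noteq> \<zero>"
  obtains U where "U \<in> ultrafilters R" "x \<in> U"
proof -
  define proper where "proper = {U. U \<subseteq> carrier R \<and> \<one> \<in> U \<and> \<zero> \<notin> U \<and> x \<in> U \<and>
         (\<forall>y\<in>U. \<forall>z\<in>U. y \<otimes> z \<in> U) \<and> (\<forall>y\<in>U. \<forall>z\<in>carrier R. y \<otimes> z = y \<longrightarrow> z \<in> U)}"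
  \<comment> \<open>The principal filter of \<open>x\<close>.\<close>
  have "{y \<in> carrier R. x \<otimes> y = x} \<in> proper"
    using x by (auto simp: proper_def idem) (metis m_assoc)+
  then have ne: "proper \<noteq> {}" by blast
  have chain: "\<Union>\<C> \<in> proper" if "\<C> \<noteq> {}" "subset.chain proper \<C>" for \<C>
  proof -
    have sub: "\<C> \<subseteq> proper" and tot: "\<And>U V. U \<in> \<C> \<Longrightarrow> V \<in> \<C> \<Longrightarrow> U \<subseteq> V \<or> V \<subseteq> U"
      using that(2) by (auto simp: subset_chain_def)
    have mult: "y \<otimes> z \<in> \<Union>\<C>" if yz: "y \<in> \<Union>\<C>" "z \<in> \<Union>\<C>" for y z
    proof -
      obtain U where U: "U \<in> \<C>" "y \<in> U" "z \<in> U" using yz tot by blast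
      then have "y \<otimes> z \<in> U" using sub by (auto simp: proper_def)
      then show ?thesis using U(1) by blast
    qed
    have up: "z \<in> \<Union>\<C>" if "y \<in> \<Union>\<C>" "z \<in> carrier R" "y \<otimes> z = y" for y z
      using that sub unfolding proper_def by blast
    have "\<Union>\<C> \<subseteq> carrier R" "\<one> \<in> \<Union>\<C>" "\<zero> \<notin> \<Union>\<C>" "x \<in> \<Union>\<C>"
      using sub \<open>\<C> \<noteq> {}\<close> unfolding proper_def by blast+
    then show ?thesis using mult up unfolding proper_def by blast
  qed
  obtain U where U: "U \<in> proper" and max: "\<And>V. V \<in> proper \<Longrightarrow> U \<subseteq> V \<Longrightarrow> V = U"
    using subset_Zorn_nonempty[OF ne chain] by blast
  note U' = U[unfolded proper_def, simplified]
  have carr: "y \<in> carrier R" if "y \<in> U" for y using U' that by blast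
  have "z \<in> U \<or> \<one> \<oplus> z \<in> U" if z: "z \<in> carrier R" for z
  proof (cases "\<exists>u\<in>U. u \<otimes> z = \<zero>")
    case True
    then obtain u where u: "u \<in> U" "u \<otimes> z = \<zero>" by blast
    then have "u \<otimes> (\<one> \<oplus> z) = u" using z carr by (simp add: r_distr)
    then show ?thesis using u(1) z U' by (meson add.m_closed one_closed)
  next
    case False
    \<comment> \<open>The filter generated by \<open>U\<close> and \<open>z\<close>.\<close>
    define V where "V = {y \<in> carrier R. \<exists>u\<in>U. (u \<otimes> z) \<otimes> y = u \<otimes> z}"
    have UV: "U \<subseteq> V"
    proof
      fix u assume u: "u \<in> U"
      have "(u \<otimes> z) \<otimes> u = u \<otimes> z" using u z carr idem by (metis m_assoc m_comm)
      then show "u \<in> V" using u carr by (auto simp: V_def)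
    qed
    have "z \<in> V" using z U' idem by (auto simp: V_def intro!: bexI[of _ \<one>])
    have "V \<in> proper"
    proof -
      have sub: "V \<subseteq> carrier R" by (auto simp: V_def)
      have zero: "\<zero> \<notin> V" using False z carr by (auto simp: V_def)
      have mult: "y \<otimes> y' \<in> V" if V: "y \<in> V" "y' \<in> V" for y y'
      proof -
        obtain u u' where u: "u \<in> U" "(u \<otimes> z) \<otimes> y = u \<otimes> z" "u' \<in> U" "(u' \<otimes> z) \<otimes> y' = u' \<otimes> z"
          and y: "y \<in> carrier R" "y' \<in> carrier R" using V unfolding V_def by blast
        have c: "u \<in> carrier R" "u' \<in> carrier R" using u carr by auto
        have zz: "z \<otimes> z = z" using z idem by blast
        have e: "(u \<otimes> u') \<otimes> z = (u \<otimes> z) \<otimes> (u' \<otimes> z)"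
        proof -
          have "(u \<otimes> z) \<otimes> (u' \<otimes> z) = (u \<otimes> u') \<otimes> (z \<otimes> z)" using c z by (simp add: m_ac)
          then show ?thesis by (simp add: zz)
        qed
        have "((u \<otimes> u') \<otimes> z) \<otimes> (y \<otimes> y') = ((u \<otimes> z) \<otimes> y) \<otimes> ((u' \<otimes> z) \<otimes> y')"
          unfolding e using c y z by (simp add: m_ac)
        then have "((u \<otimes> u') \<otimes> z) \<otimes> (y \<otimes> y') = (u \<otimes> u') \<otimes> z" using u e by simp
        moreover have "u \<otimes> u' \<in> U" using u U' by blast
        ultimately show ?thesis using y unfolding V_def by blast
      qed
      have up: "y' \<in> V" if V: "y \<in> V" "y' \<in> carrier R" "y \<otimes> y' = y" for y y'
      proof -
        obtain u where u: "u \<in> U" "(u \<otimes> z) \<otimes> y = u \<otimes> z" and y: "y \<in> carrier R"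
          using V(1) unfolding V_def by blast
        have "(u \<otimes> z) \<otimes> y' = u \<otimes> z" using u y z V carr by (metis m_assoc m_closed)
        then show ?thesis using u V unfolding V_def by blast
      qed
      have one: "\<one> \<in> V" "x \<in> V" using UV U' by blast+
      show ?thesis
        unfolding proper_def
        by (intro CollectI conjI ballI impI) (fact sub zero one | rule mult, assumption+ | rule up, assumption+)+
    qed
    then show ?thesis using max UV \<open>z \<in> V\<close> by blast
  qed
  then have "U \<in> ultrafilters R" using U' by (simp add: ultrafilters_def)
  then show ?thesis using that U' by blast
qed

text \<open>
  Ultrafilters detect the order \<open>a b = a\<close>: if \<open>a\<close> is not below \<open>b\<close>, the nonzero
  element \<open>a (1 + b)\<close> lies in an ultrafilter, which contains \<open>a\<close> and the complement
  of \<open>b\<close>.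
\<close>

lemma mult_eq_if_ultrafilters_subset:
  assumes a: "a \<in> carrier R" and b: "b \<in> carrier R"
    and le: "\<And>U. U \<in> ultrafilters R \<Longrightarrow> a \<in> U \<Longrightarrow> b \<in> U"
  shows "a \<otimes> b = a"
proof -
  define c where "c = \<one> \<oplus> b"
  have c: "c \<in> carrier R" using b by (simp add: c_def)
  have d: "a \<otimes> c \<in> carrier R" using a c by simp
  have "a \<otimes> c = \<zero>"
  proof (rule ccontr)
    assume "a \<otimes> c \<noteq> \<zero>"
    then obtain U where U: "U \<in> ultrafilters R" "a \<otimes> c \<in> U" using ultrafilter_exists[OF d] by blast
    have up: "y \<in> U" if "y \<in> carrier R" "(a \<otimes> c) \<otimes> y = a \<otimes> c" for y
      using U that unfolding ultrafilters_def by blast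
    have "(a \<otimes> c) \<otimes> c = a \<otimes> c" using a c by (simp add: m_assoc idem)
    then have "c \<in> U" using up c by blast
    have "(a \<otimes> c) \<otimes> a = (a \<otimes> a) \<otimes> c" using a c by (simp add: m_ac)
    then have "(a \<otimes> c) \<otimes> a = a \<otimes> c" using a by (simp add: idem)
    then have "b \<in> U" using up a le U(1) by blast
    then show False using \<open>c \<in> U\<close> ultrafilter_compl_iff[OF U(1) b] unfolding c_def by blast
  qed
  then have "a \<oplus> a \<otimes> b = \<zero>" using a b by (simp add: c_def r_distr)
  then have "a = a \<otimes> b" using add_eq_zero a b by blast
  then show ?thesis by simp
qed

lemma stone_representation_inj: "inj_on (\<lambda>x. {U \<in> ultrafilters R. x \<in> U}) (carrier R)"
proof (rule inj_onI)
  fix x y assume xy: "x \<in> carrier R" "y \<in> carrier R"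
    and eq: "{U \<in> ultrafilters R. x \<in> U} = {U \<in> ultrafilters R. y \<in> U}"
  have "x \<in> U \<longleftrightarrow> y \<in> U" if "U \<in> ultrafilters R" for U
    using arg_cong[OF eq, of "\<lambda>S. U \<in> S"] that by simp
  then have "x \<otimes> y = x" "y \<otimes> x = y"
    by (auto intro!: mult_eq_if_ultrafilters_subset xy)
  then show "x = y" using m_comm[OF xy] by simp
qed

lemma openin_stone_basic: "x \<in> carrier R \<Longrightarrow> openin (stone_space R) {U \<in> ultrafilters R. x \<in> U}"
  unfolding stone_space_def by (rule topology_generated_by_Basis) simp

lemma stone_basic_compl:
  assumes x: "x \<in> carrier R"
  shows "ultrafilters R - {U \<in> ultrafilters R. x \<in> U} = {U \<in> ultrafilters R. \<one> \<oplus> x \<in> U}"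
  using ultrafilter_compl_iff[OF _ x] by blast

lemma closedin_stone_basic:
  assumes x: "x \<in> carrier R" shows "closedin (stone_space R) {U \<in> ultrafilters R. x \<in> U}"
  unfolding closedin_def topspace_stone_space[OF ring_axioms] stone_basic_compl[OF x]
  using x openin_stone_basic by auto

lemma Hausdorff_stone_space: "Hausdorff_space (stone_space R)"
  unfolding Hausdorff_space_def topspace_stone_space[OF ring_axioms]
proof (intro allI impI)
  fix U V assume UV: "U \<in> ultrafilters R \<and> V \<in> ultrafilters R \<and> U \<noteq> V"
  then have U: "U \<in> ultrafilters R" and V: "V \<in> ultrafilters R" and "U \<noteq> V" by auto
  have "\<exists>x\<in>U. x \<notin> V"
  proof (rule ccontr)
    assume "\<not> (\<exists>x\<in>U. x \<notin> V)"
    then obtain x where x: "x \<in> V" "x \<notin> U" and sub: "U \<subseteq> V" using \<open>U \<noteq> V\<close> by blast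
    have xR: "x \<in> carrier R" using ultrafilter_in_carrier[OF V x(1)] .
    then have "\<one> \<oplus> x \<in> V" using ultrafilter_compl_iff[OF U] x(2) sub by blast
    then show False using ultrafilter_compl_iff[OF V xR] x(1) by blast
  qed
  then obtain x where x: "x \<in> U" "x \<notin> V" by blast
  have xR: "x \<in> carrier R" using ultrafilter_in_carrier[OF U x(1)] .
  let ?S = "\<lambda>x. {U \<in> ultrafilters R. x \<in> U}"
  have "openin (stone_space R) (?S x)" "openin (stone_space R) (?S (\<one> \<oplus> x))"
    using xR openin_stone_basic by simp_all
  moreover have "U \<in> ?S x" "V \<in> ?S (\<one> \<oplus> x)" using x U V ultrafilter_compl_iff[OF V xR] by auto
  moreover have "disjnt (?S x) (?S (\<one> \<oplus> x))" using ultrafilter_compl_iff[OF _ xR] by (auto simp: disjnt_def)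
  ultimately show "\<exists>S T. openin (stone_space R) S \<and> openin (stone_space R) T \<and> U \<in> S \<and> V \<in> T \<and> disjnt S T"
    by blast
qed

end

text \<open>
  An ultrafilter of the target ring of a surjective map is the image of its own preimage.
\<close>

lemma stone_map_inj:
  assumes surj: "f ` carrier R = carrier S"
  shows "inj_on (stone_map R f) (ultrafilters S)"
proof (rule inj_onI)
  fix U V assume UV: "U \<in> ultrafilters S" "V \<in> ultrafilters S" "stone_map R f U = stone_map R f V"
  have image: "f ` stone_map R f W = W" if "W \<in> ultrafilters S" for W
  proof -
    have "W \<subseteq> f ` carrier R" using that by (auto simp: ultrafilters_def surj)
    then show ?thesis by (auto simp: stone_map_def)
  qed
  show "U = V" using image UV by metis
qed

section \<open>Countability from the topology of the Cantor space\<close>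

instance bool :: second_countable_topology
proof
  have "open = generate_topology (UNIV :: bool set set)"
    by (intro ext) (simp add: open_discrete generate_topology.Basis)
  then show "\<exists>B :: bool set set. countable B \<and> open = generate_topology B"
    using countable_finite[OF finite] by blast
qed

text \<open>
  By compactness, such a set is a union of finitely many members of a countable basis.
\<close>

lemma countable_compact_open:
  "countable {S :: 'a :: second_countable_topology set. compact S \<and> open S}"
proof -
  obtain \<B> :: "'a set set" where \<B>: "countable \<B>" "topological_basis \<B>"
    using ex_countable_basis by blast
  have "{S. compact S \<and> open S} \<subseteq> Union ` {\<F>. finite \<F> \<and> \<F> \<subseteq> \<B>}"
  proof
    fix S :: "'a set" assume "S \<in> {S. compact S \<and> open S}"
    then have S: "compact S" "open S" by auto
    obtain \<C> where \<C>: "\<C> \<subseteq> \<B>" "\<Union>\<C> = S" using \<B>(2) S(2) unfolding topological_basis_def by blast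
    then obtain \<F> where "\<F> \<subseteq> \<C>" "finite \<F>" "S \<subseteq> \<Union>\<F>"
      using compactE[OF S(1), of \<C>] topological_basis_open[OF \<B>(2)] by blast
    then have "\<Union>\<F> = S" "finite \<F>" "\<F> \<subseteq> \<B>" using \<C> by blast+
    then show "S \<in> Union ` {\<F>. finite \<F> \<and> \<F> \<subseteq> \<B>}" by blast
  qed
  then show ?thesis
    using countable_Collect_finite_subset[OF \<B>(1)] by (meson countable_image countable_subset)
qed

text \<open>
  This identification gives access to the countable basis of the function type
  \<^typ>\<open>nat \<Rightarrow> bool\<close>.
\<close>

lemma cantor_space_euclidean: "cantor_space = euclidean"
proof -
  have "discrete_topology (UNIV :: bool set) = euclidean"
    by (simp add: topology_eq open_discrete)
  then show ?thesis by (simp add: cantor_space_def euclidean_product_topology)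
qed

lemma compact_cantor_space: "compact_space cantor_space"
  by (simp add: cantor_space_def compact_space_product_topology compact_space_discrete_topology)

lemma infinite_cantor_space: "infinite (topspace cantor_space)"
proof
  assume "finite (topspace cantor_space)"
  then have "finite (range (\<lambda>(n::nat) m. m = n))"
    by (rule finite_subset[rotated]) (simp add: cantor_space_euclidean)
  moreover have "inj (\<lambda>(n::nat) m. m = n)" by (rule injI) metis
  ultimately show False using finite_imageD infinite_UNIV_nat by blast
qed

text \<open>
  A finite ring has only finitely many subsets, hence finitely many ultrafilters, but the Cantor
  space has infinitely many points.  For countability, the clopen sets of the Stone representation,
  which are compact and open, are transported to the Cantor space.
\<close>

lemma (in boolean_ring) cantor_dual_imp_infinite_countable:
  assumes hom: "stone_space R homeomorphic_space cantor_space"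
  shows "infinite (carrier R)" "countable (carrier R)"
proof -
  obtain f where f: "homeomorphic_map (stone_space R) cantor_space f"
    using hom by (auto simp: homeomorphic_space)
  have ts: "topspace (stone_space R) = ultrafilters R" by (rule topspace_stone_space[OF ring_axioms])
  show "infinite (carrier R)"
  proof
    assume "finite (carrier R)"
    then have "finite (ultrafilters R)"
      by (rule finite_subset[rotated, OF finite_Pow_iff[THEN iffD2]]) (auto simp: ultrafilters_def)
    then have "finite (topspace cantor_space)"
      using homeomorphic_imp_surjective_map[OF f] ts by (metis finite_imageI)
    then show False using infinite_cantor_space by contradiction
  qed
  let ?S = "\<lambda>x. {U \<in> ultrafilters R. x \<in> U}"
  have comp: "compact_space (stone_space R)"
    using homeomorphic_compact_space[OF hom] compact_cantor_space by blast
  have "compact (f ` ?S x) \<and> open (f ` ?S x)" if x: "x \<in> carrier R" for x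
  proof
    have "compactin (stone_space R) (?S x)"
      using comp closedin_stone_basic[OF x] by (rule closedin_compact_space)
    then have "compactin cantor_space (f ` ?S x)"
      using homeomorphic_imp_continuous_map[OF f] by (rule image_compactin)
    then show "compact (f ` ?S x)" by (simp add: cantor_space_euclidean)
    show "open (f ` ?S x)"
      using homeomorphic_imp_open_map[OF f] openin_stone_basic[OF x]
      by (simp add: open_map_def cantor_space_euclidean)
  qed
  then have "(\<lambda>x. f ` ?S x) ` carrier R \<subseteq> {S. compact S \<and> open S}" by blast
  then have "countable ((\<lambda>x. f ` ?S x) ` carrier R)"
    by (rule countable_subset) (rule countable_compact_open)
  moreover have "inj_on (\<lambda>x. f ` ?S x) (carrier R)"
  proof (rule inj_onI)
    fix x y assume xy: "x \<in> carrier R" "y \<in> carrier R" "f ` ?S x = f ` ?S y"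
    have "inj_on f (ultrafilters R)" using homeomorphic_imp_injective_map[OF f] ts by simp
    then have "?S x = ?S y" using inj_on_image_eq_iff[of f "ultrafilters R" "?S x" "?S y"] xy(3) by blast
    then show "x = y" using stone_representation_inj xy by (auto dest: inj_onD)
  qed
  ultimately show "countable (carrier R)" using countable_image_inj_on by blast
qed

section \<open>The map on ends induced by a free factor\<close>

lemma boolean_ring_ends_algebra: assumes G: "group G" shows "boolean_ring (ends_algebra G)"
proof -
  interpret ideal "finite_subsets G" "commensurated_algebra G" by (rule ideal_finite_subsets[OF G])
  interpret Q: cring "ends_algebra G"
    unfolding ends_algebra_def by (rule quotient_is_cring[OF cring_commensurated_algebra[OF G]])
  show ?thesis
  proof
    fix X assume "X \<in> carrier (ends_algebra G)"
    then obtain A where A: "A \<in> carrier (commensurated_algebra G)"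
      "X = finite_subsets G +>\<^bsub>commensurated_algebra G\<^esub> A"
      by (auto simp: ends_algebra_def FactRing_def A_RCOSETS_def')
    have "A \<otimes>\<^bsub>commensurated_algebra G\<^esub> A = A" by (simp add: commensurated_algebra_def)
    then show "X \<otimes>\<^bsub>ends_algebra G\<^esub> X = X"
      using rcoset_mult_add[OF A(1) A(1)] by (simp add: A(2) ends_algebra_def FactRing_def)
  qed
qed

theorem proposition1p23:
  fixes G :: "('a, 'm) monoid_scheme" and H L :: "'a set"
  assumes "group G"
    and "free_product_decomposition G H L"
    and "ends_space (G\<lparr>carrier := H\<rparr>) homeomorphic_space cantor_space"
  shows "continuous_map (ends_space (G\<lparr>carrier := H\<rparr>)) (ends_space G) (ends_map G H)
    \<and> inj_on (ends_map G H) (topspace (ends_space (G\<lparr>carrier := H\<rparr>)))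
    \<and> (\<exists>C \<subseteq> topspace (ends_space G).
          subtopology (ends_space G) C homeomorphic_space cantor_space)
    \<and> ideal (a_kernel (ends_algebra G) (ends_algebra (G\<lparr>carrier := H\<rparr>)) (ends_restrict G H))
        (ends_algebra G)
    \<and> ends_algebra G Quot
          a_kernel (ends_algebra G) (ends_algebra (G\<lparr>carrier := H\<rparr>)) (ends_restrict G H)
        \<simeq> ends_algebra (G\<lparr>carrier := H\<rparr>)
    \<and> infinite (carrier (ends_algebra (G\<lparr>carrier := H\<rparr>)))
    \<and> countable (carrier (ends_algebra (G\<lparr>carrier := H\<rparr>)))"
proof -
  let ?H = "G\<lparr>carrier := H\<rparr>"
  have sub: "subgroup H G" using assms(2) by (simp add: free_product_decomposition_def)
  then have gH: "group ?H" using assms(1) by (simp add: subgroup.subgroup_is_group)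
  interpret RG: boolean_ring "ends_algebra G" by (rule boolean_ring_ends_algebra[OF assms(1)])
  interpret RH: boolean_ring "ends_algebra ?H" by (rule boolean_ring_ends_algebra[OF gH])
  have hom: "ends_restrict G H \<in> ring_hom (ends_algebra G) (ends_algebra ?H)"
    by (rule ends_restrict_hom[OF assms(1) sub])
  interpret f: ring_hom_ring "ends_algebra G" "ends_algebra ?H" "ends_restrict G H"
    by (rule ring_hom_ringI2[OF RG.ring_axioms RH.ring_axioms hom])
  note surj = ends_restrict_surj[OF assms(1,2)]
  have cont: "continuous_map (ends_space ?H) (ends_space G) (ends_map G H)"
    unfolding ends_space_def ends_map_def
    by (rule continuous_map_stone_map[OF RG.ring_axioms RH.ring_axioms hom])
  have inj: "inj_on (ends_map G H) (topspace (ends_space ?H))"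
    unfolding ends_space_def ends_map_def topspace_stone_space[OF RH.ring_axioms]
    by (rule stone_map_inj[OF surj])
  have "compact_space (ends_space ?H)"
    using homeomorphic_compact_space[OF assms(3)] compact_cantor_space by blast
  moreover have "Hausdorff_space (ends_space G)"
    unfolding ends_space_def by (rule RG.Hausdorff_stone_space)
  ultimately have "embedding_map (ends_space ?H) (ends_space G) (ends_map G H)"
    by (intro continuous_imp_embedding_map cont inj)
  then have "subtopology (ends_space G) (ends_map G H ` topspace (ends_space ?H)) homeomorphic_space cantor_space"
    using embedding_map_imp_homeomorphic_space homeomorphic_space_sym homeomorphic_space_trans assms(3) by blast
  moreover have "ends_map G H ` topspace (ends_space ?H) \<subseteq> topspace (ends_space G)"
    using cont by (rule continuous_map_image_subset_topspace)
  ultimately have "\<exists>C \<subseteq> topspace (ends_space G). subtopology (ends_space G) C homeomorphic_space cantor_space"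
    by blast
  then show ?thesis
    using cont inj f.kernel_is_ideal f.FactRing_iso[OF surj]
      RH.cantor_dual_imp_infinite_countable assms(3)[unfolded ends_space_def] by blast
qed

end
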